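(* Let $\|\cdot\|_{D^{(n)}}$, $n\in\mathbb{N}$, be a sequence of arbitrary $D$-norms on $\mathbb{R}^d$. Then the limit $$\lim_{n\to\infty}\|\bm{x}\|_{\prod_{i=1}^n D^{(i)}}=:f(\bm{x})$$ exists for each $\bm{x}\in\mathbb{R}^d$, and $f$ is a $D$-norm on $\mathbb{R}^d$.
   Context: A generator is a random vector $\bm{Z}=(Z_1,\dots,Z_d)$ with $Z_i\ge 0$ almost surely and $E(Z_i)=1$ for $1\le i\le d$. The $D$-norm on $\mathbb{R}^d$ generated by $\bm{Z}$ is $\|\bm{x}\|_D:=E\left(\max_{1\le i\le d}(|x_i|Z_i)\right)$, $\bm{x}\in\mathbb{R}^d$. A $D$-norm is a norm on $\mathbb{R}^d$ that arises in this way from some generator; the generator of a $D$-norm is not unique. For two $D$-norms $\|\cdot\|_{D^{(1)}}$, $\|\cdot\|_{D^{(2)}}$ on $\mathbb{R}^d$, their product $\|\cdot\|_{D^{(1)}D^{(2)}}$ is the $D$-norm generated by the componentwise product $\bm{Z}^{(1)}\bm{Z}^{(2)}$, where $\bm{Z}^{(1)}$, $\bm{Z}^{(2)}$ are independent generators of $\|\cdot\|_{D^{(1)}}$, $\|\cdot\|_{D^{(2)}}$; it does not depend on the choice of these independent generators. Iterated products are defined by $\|\cdot\|_{\prod_{i=1}^{1}D^{(i)}}:=\|\cdot\|_{D^{(1)}}$ and $\|\cdot\|_{\prod_{i=1}^{n+1}D^{(i)}}:=\|\cdot\|_{D^{(n+1)}\prod_{i=1}^n D^{(i)}}$, $n\in\mathbb{N}$.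 *)

theory Defs
  imports "HOL-Probability.Probability"
begin

definition generator :: "'a measure \<Rightarrow> ('a \<Rightarrow> real ^ 'd) \<Rightarrow> bool" where
  "generator M Z \<longleftrightarrow>
     prob_space M \<and> Z \<in> borel_measurable M \<and>
     (\<forall>i. (AE \<omega> in M. 0 \<le> Z \<omega> $ i) \<and>
          integrable M (\<lambda>\<omega>. Z \<omega> $ i) \<and> (\<integral>\<omega>. Z \<omega> $ i \<partial>M) = 1)"

definition dnorm :: "'a measure \<Rightarrow> ('a \<Rightarrow> real ^ 'd) \<Rightarrow> real ^ 'd \<Rightarrow> real" where
  "dnorm M Z x = (\<integral>\<omega>. (MAX i. \<bar>x $ i\<bar> * Z \<omega> $ i) \<partial>M)"

text \<open>
  HOL cannot quantify over sample spaces of all types.  A \<open>D\<close>-norm depends only on the law of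
  its generator, so the sample space \<open>real ^ 'd\<close> suffices; see \<open>is_dnorm_dnorm\<close> below for
  generators on arbitrary probability spaces.
\<close>

definition is_dnorm :: "(real ^ 'd \<Rightarrow> real) \<Rightarrow> bool" where
  "is_dnorm N \<longleftrightarrow>
     (\<exists>(M :: (real ^ 'd) measure) Z. generator M Z \<and> N = dnorm M Z)"

text \<open>
  Independent pairs of generators are likewise taken on the type \<open>(real ^ 'd) \<times> (real ^ 'd)\<close>.
  That the description determines a unique function, and that pairs on any other probability
  space give the same function, is \<open>dnorm_mult_eq\<close> below.  Multiplication on \<open>real ^ 'd\<close> is
  componentwise.
\<close>

definition dnorm_mult ::
    "(real ^ 'd \<Rightarrow> real) \<Rightarrow> (real ^ 'd \<Rightarrow> real) \<Rightarrow> real ^ 'd \<Rightarrow> real" where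
  "dnorm_mult N1 N2 =
     (THE N. \<exists>(M :: ((real ^ 'd) \<times> (real ^ 'd)) measure) Z1 Z2.
        generator M Z1 \<and> generator M Z2 \<and>
        prob_space.indep_var M borel Z1 borel Z2 \<and>
        N1 = dnorm M Z1 \<and> N2 = dnorm M Z2 \<and>
        N = dnorm M (\<lambda>\<omega>. Z1 \<omega> * Z2 \<omega>))"

text \<open>Sequences are indexed from \<open>0\<close>: \<open>dnorm_prod D n\<close> is the product of \<open>D 0, \<dots>, D n\<close>.\<close>

primrec dnorm_prod :: "(nat \<Rightarrow> real ^ 'd \<Rightarrow> real) \<Rightarrow> nat \<Rightarrow> real ^ 'd \<Rightarrow> real" where
  "dnorm_prod D 0 = D 0"
| "dnorm_prod D (Suc n) = dnorm_mult (D (Suc n)) (dnorm_prod D n)"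

lemma borel_measurable_vec_iff:
  fixes f :: "'a \<Rightarrow> real ^ 'd"
  shows "f \<in> borel_measurable M \<longleftrightarrow> (\<forall>i. (\<lambda>\<omega>. f \<omega> $ i) \<in> borel_measurable M)"
  by (subst borel_measurable_euclidean_space) (auto simp: Basis_vec_def inner_axis)

lemma borel_measurable_vec_component [measurable (raw)]:
  fixes f :: "'a \<Rightarrow> real ^ 'd"
  shows "f \<in> borel_measurable M \<Longrightarrow> (\<lambda>\<omega>. f \<omega> $ i) \<in> borel_measurable M"
  by (simp add: borel_measurable_vec_iff)

lemma borel_measurable_Max_vec [measurable]:
  fixes Z :: "'a \<Rightarrow> real ^ 'd"
  assumes [measurable]: "Z \<in> borel_measurable M"
  shows "(\<lambda>\<omega>. MAX i. \<bar>x $ i\<bar> * Z \<omega> $ i) \<in> borel_measurable M"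
  by (intro borel_measurable_Max) auto

lemma generator_distr:
  fixes Z :: "'b \<Rightarrow> real ^ 'd"
  assumes "prob_space M" and [measurable]: "T \<in> measurable M N" "Z \<in> borel_measurable N"
  shows "generator (distr M N T) Z \<longleftrightarrow> generator M (\<lambda>\<omega>. Z (T \<omega>))"
  using assms(1) prob_space.prob_space_distr[OF assms(1,2)]
  by (simp add: generator_def AE_distr_iff integrable_distr_eq integral_distr)

lemma dnorm_distr:
  fixes Z :: "'b \<Rightarrow> real ^ 'd"
  assumes [measurable]: "T \<in> measurable M N" "Z \<in> borel_measurable N"
  shows "dnorm (distr M N T) Z = dnorm M (\<lambda>\<omega>. Z (T \<omega>))"
  by (simp add: dnorm_def integral_distr fun_eq_iff)

lemma is_dnorm_dnorm:
  fixes M :: "'a measure"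
  assumes "generator M Z"
  shows "is_dnorm (dnorm M Z)"
proof -
  have Z: "prob_space M" "Z \<in> borel_measurable M"
    using assms by (auto simp: generator_def)
  have "generator (distr M borel Z) (\<lambda>x. x)" "dnorm M Z = dnorm (distr M borel Z) (\<lambda>x. x)"
    using assms Z by (simp_all add: generator_distr dnorm_distr)
  then show ?thesis unfolding is_dnorm_def by blast
qed

lemma generator_pair:
  fixes Z :: "'a \<Rightarrow> real ^ 'd" and W :: "'b \<Rightarrow> real ^ 'd"
  assumes gZ: "generator M Z" and gW: "generator N W"
  defines "K \<equiv> M \<Otimes>\<^sub>M N"
  shows "generator K (\<lambda>\<omega>. Z (fst \<omega>))" "generator K (\<lambda>\<omega>. W (snd \<omega>))"
    "prob_space.indep_var K borel (\<lambda>\<omega>. Z (fst \<omega>)) borel (\<lambda>\<omega>. W (snd \<omega>))"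
    "dnorm K (\<lambda>\<omega>. Z (fst \<omega>)) = dnorm M Z" "dnorm K (\<lambda>\<omega>. W (snd \<omega>)) = dnorm N W"
    "distr K M fst = M" "distr K N snd = N"
proof -
  have [measurable]: "Z \<in> borel_measurable M" "W \<in> borel_measurable N"
    and M: "prob_space M" and N: "prob_space N"
    using assms by (auto simp: generator_def)
  interpret M: prob_space M by fact
  interpret N: prob_space N by fact
  interpret P: pair_prob_space M N ..
  have K: "prob_space K" unfolding K_def by (rule prob_space_pair) fact+
  have f: "distr K M fst = M" unfolding K_def by (rule N.distr_pair_fst)
  have s: "distr K N snd = N"
  proof -
    have "distr K N snd = distr (N \<Otimes>\<^sub>M M) N fst"
      unfolding K_def
      by (subst P.distr_pair_swap) (subst distr_distr, auto simp: comp_def case_prod_beta')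
    then show ?thesis by (simp add: M.distr_pair_fst)
  qed
  have [measurable]: "fst \<in> measurable K M" "snd \<in> measurable K N"
    unfolding K_def by auto
  show "generator K (\<lambda>\<omega>. Z (fst \<omega>))" "generator K (\<lambda>\<omega>. W (snd \<omega>))"
    using generator_distr[of K fst M Z] generator_distr[of K snd N W] gZ gW K f s by simp_all
  show "dnorm K (\<lambda>\<omega>. Z (fst \<omega>)) = dnorm M Z" "dnorm K (\<lambda>\<omega>. W (snd \<omega>)) = dnorm N W"
    using dnorm_distr[of fst K M Z] dnorm_distr[of snd K N W] f s by simp_all
  have dZ: "distr K borel (\<lambda>\<omega>. Z (fst \<omega>)) = distr M borel Z"
    using distr_distr[of Z M borel fst K] f by (simp add: comp_def)
  have dW: "distr K borel (\<lambda>\<omega>. W (snd \<omega>)) = distr N borel W"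
    using distr_distr[of W N borel snd K] s by (simp add: comp_def)
  have "distr M borel Z \<Otimes>\<^sub>M distr N borel W =
      distr K (borel \<Otimes>\<^sub>M borel) (\<lambda>\<omega>. (Z (fst \<omega>), W (snd \<omega>)))"
    unfolding K_def
    by (subst pair_measure_distr)
       (auto simp: case_prod_beta' intro!: prob_space_imp_sigma_finite N.prob_space_distr)
  then show "prob_space.indep_var K borel (\<lambda>\<omega>. Z (fst \<omega>)) borel (\<lambda>\<omega>. W (snd \<omega>))"
    by (subst prob_space.indep_var_distribution_eq[OF K]) (auto simp: dZ dW)
  show "distr K M fst = M" "distr K N snd = N" by (fact f s)+
qed

lemma dnorm_times:
  fixes Z1 Z2 :: "'a \<Rightarrow> real ^ 'd"
  assumes g1: "generator M Z1" and g2: "generator M Z2"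
    and indep: "prob_space.indep_var M borel Z1 borel Z2"
  shows "dnorm M (\<lambda>\<omega>. Z1 \<omega> * Z2 \<omega>) x = (\<integral>\<omega>. dnorm M Z2 (x * Z1 \<omega>) \<partial>M)"
    and "dnorm M (\<lambda>\<omega>. Z1 \<omega> * Z2 \<omega>) x = (\<integral>\<omega>. dnorm M Z1 (x * Z2 \<omega>) \<partial>M)"
    and "generator M (\<lambda>\<omega>. Z1 \<omega> * Z2 \<omega>)"
proof -
  have Z[measurable]: "Z1 \<in> borel_measurable M" "Z2 \<in> borel_measurable M"
    and M: "prob_space M"
    using assms by (auto simp: generator_def)
  interpret prob_space M by fact
  let ?P1 = "distr M borel Z1" and ?P2 = "distr M borel Z2"
  interpret P1: prob_space ?P1 by (intro prob_space_distr) auto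
  interpret P2: prob_space ?P2 by (intro prob_space_distr) auto
  interpret P: pair_prob_space ?P1 ?P2 ..
  have joint: "?P1 \<Otimes>\<^sub>M ?P2 = distr M (borel \<Otimes>\<^sub>M borel) (\<lambda>\<omega>. (Z1 \<omega>, Z2 \<omega>))"
    using indep unfolding indep_var_distribution_eq by blast
  have indep_i: "indep_var borel (\<lambda>\<omega>. Z1 \<omega> $ i) borel (\<lambda>\<omega>. Z2 \<omega> $ i)" for i
    using indep_var_compose[OF indep, of "\<lambda>v. v $ i" borel "\<lambda>v. v $ i" borel]
    by (simp add: comp_def)
  have int_i: "integrable M (\<lambda>\<omega>. Z1 \<omega> $ i * Z2 \<omega> $ i)" for i
    using indep_var_integrable[OF indep_i[of i]] g1 g2 by (auto simp: generator_def)
  have exp_i: "(\<integral>\<omega>. Z1 \<omega> $ i * Z2 \<omega> $ i \<partial>M) = 1" for i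
    using indep_var_lebesgue_integral[OF indep_i[of i]] g1 g2 by (auto simp: generator_def)
  have AE1: "AE \<omega> in M. \<forall>i. 0 \<le> Z1 \<omega> $ i" and AE2: "AE \<omega> in M. \<forall>i. 0 \<le> Z2 \<omega> $ i"
    using g1 g2 by (auto simp: generator_def AE_all_countable)
  show "generator M (\<lambda>\<omega>. Z1 \<omega> * Z2 \<omega>)"
  proof -
    have "(\<lambda>\<omega>. Z1 \<omega> * Z2 \<omega>) = (\<lambda>\<omega>. \<chi> i. Z1 \<omega> $ i * Z2 \<omega> $ i)"
      by (simp add: fun_eq_iff vec_eq_iff)
    moreover have "\<dots> \<in> borel_measurable M"
      by (subst borel_measurable_vec_iff) simp
    moreover have "AE \<omega> in M. 0 \<le> Z1 \<omega> $ i * Z2 \<omega> $ i" for i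
      using AE1 AE2 by eventually_elim auto
    ultimately show ?thesis
      using M int_i exp_i by (simp add: generator_def)
  qed
  let ?f = "\<lambda>y z. MAX i. \<bar>x $ i\<bar> * \<bar>y $ i\<bar> * \<bar>z $ i\<bar> :: real"
  have meas[measurable]: "(\<lambda>(y, z). ?f y z) \<in> borel_measurable (borel \<Otimes>\<^sub>M borel)"
    unfolding case_prod_beta' by (intro borel_measurable_Max) auto
  have meas2[measurable]: "(\<lambda>\<omega>. ?f (Z1 \<omega>) (Z2 \<omega>)) \<in> borel_measurable M"
    by (intro borel_measurable_Max) auto
  have "integrable M (\<lambda>\<omega>. ?f (Z1 \<omega>) (Z2 \<omega>))"
  proof (rule Bochner_Integration.integrable_bound)
    show "integrable M (\<lambda>\<omega>. \<Sum>i\<in>UNIV. \<bar>x $ i\<bar> * \<bar>Z1 \<omega> $ i * Z2 \<omega> $ i\<bar>)"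
      using int_i by auto
    show "AE \<omega> in M. norm (?f (Z1 \<omega>) (Z2 \<omega>))
        \<le> norm (\<Sum>i\<in>UNIV. \<bar>x $ i\<bar> * \<bar>Z1 \<omega> $ i * Z2 \<omega> $ i\<bar>)"
    proof (rule AE_I2)
      fix \<omega>
      have "?f (Z1 \<omega>) (Z2 \<omega>) \<le> (\<Sum>i\<in>UNIV. \<bar>x $ i\<bar> * \<bar>Z1 \<omega> $ i * Z2 \<omega> $ i\<bar>)"
        by (auto simp: abs_mult mult.assoc intro!: member_le_sum)
      moreover have "0 \<le> ?f (Z1 \<omega>) (Z2 \<omega>)"
        by (subst Max_ge_iff) auto
      ultimately show "norm (?f (Z1 \<omega>) (Z2 \<omega>))
          \<le> norm (\<Sum>i\<in>UNIV. \<bar>x $ i\<bar> * \<bar>Z1 \<omega> $ i * Z2 \<omega> $ i\<bar>)"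
        unfolding real_norm_def by linarith
    qed
  qed measurable
  then have int: "integrable (?P1 \<Otimes>\<^sub>M ?P2) (\<lambda>(y, z). ?f y z)"
    unfolding joint by (subst integrable_distr_eq) auto
  have "dnorm M (\<lambda>\<omega>. Z1 \<omega> * Z2 \<omega>) x = (\<integral>\<omega>. ?f (Z1 \<omega>) (Z2 \<omega>) \<partial>M)"
    unfolding dnorm_def
  proof (rule integral_cong_AE)
    show "(\<lambda>\<omega>. MAX i. \<bar>x $ i\<bar> * (Z1 \<omega> * Z2 \<omega>) $ i) \<in> borel_measurable M"
      unfolding vector_mult_component by (intro borel_measurable_Max) auto
    show "AE \<omega> in M. (MAX i. \<bar>x $ i\<bar> * (Z1 \<omega> * Z2 \<omega>) $ i) = ?f (Z1 \<omega>) (Z2 \<omega>)"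
      using AE1 AE2 by eventually_elim (simp add: mult.assoc)
  qed measurable
  also have "\<dots> = (\<integral>(y, z). ?f y z \<partial>(?P1 \<Otimes>\<^sub>M ?P2))"
    unfolding joint by (subst integral_distr) auto
  finally have F: "dnorm M (\<lambda>\<omega>. Z1 \<omega> * Z2 \<omega>) x = (\<integral>(y, z). ?f y z \<partial>(?P1 \<Otimes>\<^sub>M ?P2))" .
  have N2: "(\<integral>z. ?f y z \<partial>?P2) = dnorm M Z2 (x * y)" for y
  proof -
    have "(\<integral>z. ?f y z \<partial>?P2) = (\<integral>\<omega>. ?f y (Z2 \<omega>) \<partial>M)"
      by (subst integral_distr) (auto intro!: borel_measurable_Max)
    also have "\<dots> = dnorm M Z2 (x * y)"
      unfolding dnorm_def
    proof (rule integral_cong_AE)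
      show "AE \<omega> in M. ?f y (Z2 \<omega>) = (MAX i. \<bar>(x * y) $ i\<bar> * Z2 \<omega> $ i)"
        using AE2 by eventually_elim (simp add: abs_mult)
      show "(\<lambda>\<omega>. ?f y (Z2 \<omega>)) \<in> borel_measurable M" by (intro borel_measurable_Max) auto
    qed measurable
    finally show ?thesis .
  qed
  have N1: "(\<integral>y. ?f y z \<partial>?P1) = dnorm M Z1 (x * z)" for z
  proof -
    have "(\<integral>y. ?f y z \<partial>?P1) = (\<integral>\<omega>. ?f (Z1 \<omega>) z \<partial>M)"
      by (subst integral_distr) (auto intro!: borel_measurable_Max)
    also have "\<dots> = dnorm M Z1 (x * z)"
      unfolding dnorm_def
    proof (rule integral_cong_AE)
      show "AE \<omega> in M. ?f (Z1 \<omega>) z = (MAX i. \<bar>(x * z) $ i\<bar> * Z1 \<omega> $ i)"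
        using AE1 by eventually_elim (simp add: abs_mult mult_ac)
      show "(\<lambda>\<omega>. ?f (Z1 \<omega>) z) \<in> borel_measurable M" by (intro borel_measurable_Max) auto
    qed measurable
    finally show ?thesis .
  qed
  have "integrable ?P1 (\<lambda>y. dnorm M Z2 (x * y))" "integrable ?P2 (\<lambda>y. dnorm M Z1 (x * y))"
    using P.integrable_fst[OF int] P.integrable_snd[OF int] by (simp_all add: N1 N2)
  then have [measurable]: "(\<lambda>y. dnorm M Z2 (x * y)) \<in> borel_measurable borel"
      "(\<lambda>y. dnorm M Z1 (x * y)) \<in> borel_measurable borel"
    by (auto dest: borel_measurable_integrable)
  show "dnorm M (\<lambda>\<omega>. Z1 \<omega> * Z2 \<omega>) x = (\<integral>\<omega>. dnorm M Z2 (x * Z1 \<omega>) \<partial>M)"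
    using P.integral_fst[OF int] F by (simp add: N2 integral_distr)
  show "dnorm M (\<lambda>\<omega>. Z1 \<omega> * Z2 \<omega>) x = (\<integral>\<omega>. dnorm M Z1 (x * Z2 \<omega>) \<partial>M)"
    using P.integral_snd[OF int] F by (simp add: N1 integral_distr)
qed

lemma borel_measurable_dnorm:
  fixes Z :: "'a \<Rightarrow> real ^ 'd"
  assumes "generator M Z"
  shows "dnorm M Z \<in> borel_measurable borel"
proof -
  have [measurable]: "Z \<in> borel_measurable M" and "prob_space M"
    using assms by (auto simp: generator_def)
  then interpret prob_space M by simp
  have "(\<lambda>x. \<integral>\<omega>. (MAX i. \<bar>x $ i\<bar> * Z \<omega> $ i) \<partial>M) \<in> borel_measurable borel"
    by (rule borel_measurable_lebesgue_integral)
       (unfold case_prod_beta', intro borel_measurable_Max, simp, measurable)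
  then show ?thesis unfolding dnorm_def[abs_def] .
qed

lemma dnorm_times_unique:
  fixes Z1 Z2 :: "'a \<Rightarrow> real ^ 'd" and W1 W2 :: "'b \<Rightarrow> real ^ 'd"
  assumes Z: "generator M Z1" "generator M Z2" "prob_space.indep_var M borel Z1 borel Z2"
    and W: "generator N W1" "generator N W2" "prob_space.indep_var N borel W1 borel W2"
    and eq: "dnorm M Z1 = dnorm N W1" "dnorm M Z2 = dnorm N W2"
  shows "dnorm M (\<lambda>\<omega>. Z1 \<omega> * Z2 \<omega>) = dnorm N (\<lambda>\<omega>. W1 \<omega> * W2 \<omega>)"
proof
  fix x :: "real ^ 'd"
  let ?K = "M \<Otimes>\<^sub>M N"
  note K = generator_pair[OF Z(1) W(2)]
  have [measurable]: "Z1 \<in> borel_measurable M" "W2 \<in> borel_measurable N"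
    using Z W by (auto simp: generator_def)
  have times_eq: "(\<lambda>v. x * v) = (\<lambda>v. \<chi> i. x $ i * v $ i)"
    by (simp add: fun_eq_iff vec_eq_iff)
  have [measurable]: "(\<lambda>v. x * v) \<in> borel_measurable borel"
    unfolding times_eq by (subst borel_measurable_vec_iff) simp
  note [measurable] = borel_measurable_dnorm[OF Z(2)] borel_measurable_dnorm[OF W(1)]
  have "dnorm M (\<lambda>\<omega>. Z1 \<omega> * Z2 \<omega>) x = (\<integral>\<omega>. dnorm M Z2 (x * Z1 \<omega>) \<partial>(distr ?K M fst))"
    unfolding K(6) by (rule dnorm_times(1)[OF Z])
  also have "\<dots> = (\<integral>\<omega>. dnorm ?K (\<lambda>\<omega>. W2 (snd \<omega>)) (x * Z1 (fst \<omega>)) \<partial>?K)"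
    unfolding K(5) eq(2)[symmetric] by (rule integral_distr) measurable
  also have "\<dots> = (\<integral>\<omega>. dnorm ?K (\<lambda>\<omega>. Z1 (fst \<omega>)) (x * W2 (snd \<omega>)) \<partial>?K)"
    using dnorm_times(1)[OF K(1-3)] dnorm_times(2)[OF K(1-3)] by simp
  also have "\<dots> = (\<integral>\<omega>. dnorm N W1 (x * W2 \<omega>) \<partial>(distr ?K N snd))"
    unfolding K(4) eq(1) by (rule integral_distr[symmetric]) measurable
  also have "\<dots> = dnorm N (\<lambda>\<omega>. W1 \<omega> * W2 \<omega>) x"
    unfolding K(7) by (rule dnorm_times(2)[OF W, symmetric])
  finally show "dnorm M (\<lambda>\<omega>. Z1 \<omega> * Z2 \<omega>) x = dnorm N (\<lambda>\<omega>. W1 \<omega> * W2 \<omega>) x" .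
qed

lemma dnorm_mult_eq:
  fixes Z1 Z2 :: "'a \<Rightarrow> real ^ 'd"
  assumes Z: "generator M Z1" "generator M Z2" "prob_space.indep_var M borel Z1 borel Z2"
  shows "dnorm_mult (dnorm M Z1) (dnorm M Z2) = dnorm M (\<lambda>\<omega>. Z1 \<omega> * Z2 \<omega>)"
proof -
  obtain M1 :: "(real ^ 'd) measure" and W1
    where 1: "generator M1 W1" "dnorm M Z1 = dnorm M1 W1"
    using is_dnorm_dnorm[OF Z(1)] unfolding is_dnorm_def by blast
  obtain M2 :: "(real ^ 'd) measure" and W2
    where 2: "generator M2 W2" "dnorm M Z2 = dnorm M2 W2"
    using is_dnorm_dnorm[OF Z(2)] unfolding is_dnorm_def by blast
  note K = generator_pair[OF 1(1) 2(1)]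
  have eq: "dnorm M Z1 = dnorm (M1 \<Otimes>\<^sub>M M2) (\<lambda>\<omega>. W1 (fst \<omega>))"
      "dnorm M Z2 = dnorm (M1 \<Otimes>\<^sub>M M2) (\<lambda>\<omega>. W2 (snd \<omega>))"
    by (simp_all only: 1(2) 2(2) K(4,5))
  show ?thesis
    unfolding dnorm_mult_def
  proof (rule the_equality)
    show "\<exists>(K :: ((real ^ 'd) \<times> (real ^ 'd)) measure) V1 V2.
        generator K V1 \<and> generator K V2 \<and> prob_space.indep_var K borel V1 borel V2 \<and>
        dnorm M Z1 = dnorm K V1 \<and> dnorm M Z2 = dnorm K V2 \<and>
        dnorm M (\<lambda>\<omega>. Z1 \<omega> * Z2 \<omega>) = dnorm K (\<lambda>\<omega>. V1 \<omega> * V2 \<omega>)"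
      by (intro exI conjI) (fact K(1-3) eq dnorm_times_unique[OF Z K(1-3) eq])+
  qed (elim exE conjE, simp only: dnorm_times_unique[OF Z])
qed

lemma is_dnorm_dnorm_mult:
  assumes "is_dnorm N1" "is_dnorm N2"
  shows "is_dnorm (dnorm_mult N1 N2)"
proof -
  obtain M1 :: "(real ^ 'a) measure" and W1 where 1: "generator M1 W1" "N1 = dnorm M1 W1"
    using assms(1) unfolding is_dnorm_def by blast
  obtain M2 :: "(real ^ 'a) measure" and W2 where 2: "generator M2 W2" "N2 = dnorm M2 W2"
    using assms(2) unfolding is_dnorm_def by blast
  note K = generator_pair[OF 1(1) 2(1)]
  show ?thesis
    using is_dnorm_dnorm[OF dnorm_times(3)[OF K(1-3)]] dnorm_mult_eq[OF K(1-3)] K(4,5) 1 2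
    by simp
qed

end

theory Submission
  imports Defs
begin

text \<open>
  Conditioning on the old factors shows that multiplying by a further \<open>D\<close>-norm can only increase
  the norm, and every \<open>D\<close>-norm is at most \<open>\<parallel>x\<parallel>\<^sub>1\<close>; so the products converge pointwise.  That a
  pointwise limit of \<open>D\<close>-norms is a \<open>D\<close>-norm is a compactness statement.  After a change of measure
  the generators are bounded by \<open>d\<close>, and their laws live on a fixed cube.  To extract a weakly
  convergent subsequence with only the one-dimensional Helly theorem at hand, the cube is
  parametrized by Schoenberg's space-filling curve, which has a Borel section.
\<close>

section \<open>Elementary bounds and monotonicity of the product\<close>

lemma mult_Max_vec:
  fixes f :: "'d::finite \<Rightarrow> real"
  assumes "0 \<le> c"
  shows "c * (MAX i. f i) = (MAX i. c * f i)"
proof -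
  have "mono (\<lambda>t. c * t)"
    using assms by (auto simp: mono_def intro: mult_left_mono)
  from mono_Max_commute[OF this, of "range f"] show ?thesis
    by (simp add: image_image)
qed

text \<open>The maximum is attained at a single index. Absolute values on the right make the bound
  valid at every point, although generators are nonnegative only almost surely, so it serves as a
  dominating function.\<close>

lemma Max_le_sum_abs:
  fixes x z :: "real ^ 'd"
  shows "\<bar>MAX i. \<bar>x $ i\<bar> * z $ i\<bar> \<le> (\<Sum>i\<in>UNIV. \<bar>x $ i\<bar> * \<bar>z $ i\<bar>)"
proof -
  have *: "\<bar>x $ i\<bar> * \<bar>z $ i\<bar> \<le> (\<Sum>i\<in>UNIV. \<bar>x $ i\<bar> * \<bar>z $ i\<bar>)" for i
    by (rule member_le_sum) auto
  have "(MAX i. \<bar>x $ i\<bar> * z $ i) \<in> range (\<lambda>i. \<bar>x $ i\<bar> * z $ i)"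
    by (rule Max_in) auto
  then obtain i where "(MAX i. \<bar>x $ i\<bar> * z $ i) = \<bar>x $ i\<bar> * z $ i" by (rule rangeE)
  then show ?thesis using *[of i] by (simp add: abs_mult)
qed

lemma integrable_Max_generator:
  assumes "generator M Z"
  shows "integrable M (\<lambda>\<omega>. MAX i. \<bar>x $ i\<bar> * Z \<omega> $ i)"
proof (rule Bochner_Integration.integrable_bound)
  show "integrable M (\<lambda>\<omega>. \<Sum>i\<in>UNIV. \<bar>x $ i\<bar> * \<bar>Z \<omega> $ i\<bar>)"
    using assms by (auto simp: generator_def)
  show "(\<lambda>\<omega>. MAX i. \<bar>x $ i\<bar> * Z \<omega> $ i) \<in> borel_measurable M"
    using assms by (auto simp: generator_def)
  show "AE \<omega> in M. norm (MAX i. \<bar>x $ i\<bar> * Z \<omega> $ i) \<le> norm (\<Sum>i\<in>UNIV. \<bar>x $ i\<bar> * \<bar>Z \<omega> $ i\<bar>)"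
    unfolding real_norm_def by (intro AE_I2 order_trans[OF Max_le_sum_abs abs_ge_self])
qed

text \<open>Since \<open>Z $ i\<close> has mean 1, \<open>\<bar>x $ i\<bar>\<close> is the
  expectation of one of the terms under the maximum.\<close>

lemma Max_abs_le_dnorm:
  assumes "generator M Z"
  shows "(MAX i. \<bar>x $ i\<bar>) \<le> dnorm M Z x"
proof (subst Max_le_iff; clarsimp)
  fix i
  have "\<bar>x $ i\<bar> = (\<integral>\<omega>. \<bar>x $ i\<bar> * Z \<omega> $ i \<partial>M)"
    using assms by (simp add: generator_def)
  also have "\<dots> \<le> dnorm M Z x"
    unfolding dnorm_def
    by (rule integral_mono[OF _ integrable_Max_generator[OF assms]])
      (use assms in \<open>auto simp: generator_def\<close>)
  finally show "\<bar>x $ i\<bar> \<le> dnorm M Z x" .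
qed

lemma dnorm_le_sum_abs:
  assumes "generator M Z"
  shows "dnorm M Z x \<le> (\<Sum>i\<in>UNIV. \<bar>x $ i\<bar>)"
proof -
  have "AE \<omega> in M. \<forall>i. 0 \<le> Z \<omega> $ i"
    using assms by (auto simp: generator_def AE_all_countable)
  then have "AE \<omega> in M. (MAX i. \<bar>x $ i\<bar> * Z \<omega> $ i) \<le> (\<Sum>i\<in>UNIV. \<bar>x $ i\<bar> * Z \<omega> $ i)"
  proof eventually_elim
    case (elim \<omega>)
    show ?case
      using Max_le_sum_abs[of x "Z \<omega>"] elim abs_le_D1 by (simp del: Max_le_iff)
  qed
  then have "dnorm M Z x \<le> (\<integral>\<omega>. (\<Sum>i\<in>UNIV. \<bar>x $ i\<bar> * Z \<omega> $ i) \<partial>M)"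
    unfolding dnorm_def
    by (intro integral_mono_AE integrable_Max_generator assms)
      (use assms in \<open>auto simp: generator_def\<close>)
  also have "\<dots> = (\<Sum>i\<in>UNIV. \<bar>x $ i\<bar>)"
    using assms by (simp add: generator_def)
  finally show ?thesis .
qed

lemma is_dnorm_le_sum_abs:
  assumes "is_dnorm N"
  shows "N x \<le> (\<Sum>i\<in>UNIV. \<bar>x $ i\<bar>)"
  using assms dnorm_le_sum_abs unfolding is_dnorm_def by blast

text \<open>Integrating over the first factor with the second held fixed leaves the first norm
  evaluated at \<open>x * Z2\<close>. This is at least the maximum norm of \<open>x * Z2\<close>,
  hence at least the integrand of the second norm. The second argument is the one bounded because
  \<open>dnorm_prod\<close> puts the new factor first.\<close>

lemma dnorm_mult_ge:
  assumes "is_dnorm N1" "is_dnorm N2"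
  shows "N2 x \<le> dnorm_mult N1 N2 x"
proof -
  obtain M1 :: "(real ^ 'a) measure" and W1 where 1: "generator M1 W1" "N1 = dnorm M1 W1"
    using assms(1) unfolding is_dnorm_def by blast
  obtain M2 :: "(real ^ 'a) measure" and W2 where 2: "generator M2 W2" "N2 = dnorm M2 W2"
    using assms(2) unfolding is_dnorm_def by blast
  let ?K = "M1 \<Otimes>\<^sub>M M2"
  let ?Z1 = "\<lambda>\<omega>. W1 (fst \<omega>)" and ?Z2 = "\<lambda>\<omega>. W2 (snd \<omega>)"
  note K = generator_pair[OF 1(1) 2(1)]
  have [measurable]: "?Z2 \<in> borel_measurable ?K"
    using K(2) by (simp add: generator_def)
  note [measurable] = borel_measurable_dnorm[OF K(1)]
  have vec: "(\<lambda>\<omega>. x * ?Z2 \<omega>) = (\<lambda>\<omega>. \<chi> i. x $ i * ?Z2 \<omega> $ i)"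
    by (simp add: fun_eq_iff vec_eq_iff)
  have [measurable]: "(\<lambda>\<omega>. x * ?Z2 \<omega>) \<in> borel_measurable ?K"
    unfolding vec by (subst borel_measurable_vec_iff) simp
  \<comment> \<open>Monotonicity of the integral requires integrability of both sides; here the
    bound by the sum of absolute values provides it.\<close>
  have int: "integrable ?K (\<lambda>\<omega>. dnorm ?K ?Z1 (x * ?Z2 \<omega>))"
  proof (rule Bochner_Integration.integrable_bound)
    show "integrable ?K (\<lambda>\<omega>. \<Sum>i\<in>UNIV. \<bar>x $ i\<bar> * \<bar>?Z2 \<omega> $ i\<bar>)"
      using K(2) by (auto simp: generator_def)
    show "AE \<omega> in ?K. norm (dnorm ?K ?Z1 (x * ?Z2 \<omega>))
        \<le> norm (\<Sum>i\<in>UNIV. \<bar>x $ i\<bar> * \<bar>?Z2 \<omega> $ i\<bar>)"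
    proof (rule AE_I2)
      fix \<omega>
      have "0 \<le> (MAX i. \<bar>(x * ?Z2 \<omega>) $ i\<bar>)"
        by (subst Max_ge_iff) auto
      then have "0 \<le> dnorm ?K ?Z1 (x * ?Z2 \<omega>)"
        using Max_abs_le_dnorm[OF K(1)] by (rule order_trans)
      then show "norm (dnorm ?K ?Z1 (x * ?Z2 \<omega>)) \<le> norm (\<Sum>i\<in>UNIV. \<bar>x $ i\<bar> * \<bar>?Z2 \<omega> $ i\<bar>)"
        using dnorm_le_sum_abs[OF K(1), of "x * ?Z2 \<omega>"]
        by (simp add: abs_mult)
    qed
  qed measurable
  have "N2 x = dnorm ?K ?Z2 x" by (simp add: 2 K(5))
  also have "\<dots> \<le> (\<integral>\<omega>. dnorm ?K ?Z1 (x * ?Z2 \<omega>) \<partial>?K)"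
    unfolding dnorm_def[of ?K ?Z2]
  proof (rule integral_mono[OF integrable_Max_generator[OF K(2)] int])
    fix \<omega>
    have "(MAX i. \<bar>x $ i\<bar> * ?Z2 \<omega> $ i) \<le> (MAX i. \<bar>(x * ?Z2 \<omega>) $ i\<bar>)"
    proof (rule Max.boundedI)
      fix a assume "a \<in> range (\<lambda>i. \<bar>x $ i\<bar> * ?Z2 \<omega> $ i)"
      then obtain i where "a = \<bar>x $ i\<bar> * ?Z2 \<omega> $ i" by (rule rangeE)
      then have "a \<le> \<bar>(x * ?Z2 \<omega>) $ i\<bar>" by (simp add: abs_mult mult_left_mono)
      also have "\<dots> \<le> (MAX i. \<bar>(x * ?Z2 \<omega>) $ i\<bar>)" by (rule Max_ge) auto
      finally show "a \<le> (MAX i. \<bar>(x * ?Z2 \<omega>) $ i\<bar>)" .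
    qed auto
    then show "(MAX i. \<bar>x $ i\<bar> * ?Z2 \<omega> $ i) \<le> dnorm ?K ?Z1 (x * ?Z2 \<omega>)"
      using Max_abs_le_dnorm[OF K(1)] order_trans by blast
  qed
  also have "\<dots> = dnorm_mult N1 N2 x"
    using dnorm_times(2)[OF K(1-3)] dnorm_mult_eq[OF K(1-3)] K(4,5) 1 2 by simp
  finally show ?thesis .
qed

section \<open>Bounded generators\<close>

text \<open>
  A change of measure with density \<open>\<parallel>Z\<parallel>\<^sub>1 / d\<close> turns \<open>Z\<close> into \<open>d Z / \<parallel>Z\<parallel>\<^sub>1\<close>; where \<open>Z = 0\<close> the
  convention \<open>0 / 0 = 0\<close> is harmless because the density vanishes.
\<close>

lemma bounded_generator:
  fixes Z :: "'a \<Rightarrow> real ^ 'd"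
  assumes "generator M Z"
  obtains M' :: "'a measure" and W :: "'a \<Rightarrow> real ^ 'd" where
    "generator M' W" "dnorm M' W = dnorm M Z"
    "\<And>\<omega> i. 0 \<le> W \<omega> $ i" "\<And>\<omega> i. W \<omega> $ i \<le> real CARD('d)"
proof
  have [measurable]: "Z \<in> borel_measurable M"
    using assms by (auto simp: generator_def)
  have pos: "AE \<omega> in M. \<forall>i. 0 \<le> Z \<omega> $ i"
    using assms by (auto simp: generator_def AE_all_countable)
  define d where "d = real CARD('d)"
  have d: "d > 0" by (simp add: d_def)
  \<comment> \<open>With absolute values the bounds on \<open>W\<close> hold everywhere, and not
    only almost surely.\<close>
  define S where "S = (\<lambda>\<omega>. \<Sum>i\<in>UNIV. \<bar>Z \<omega> $ i\<bar>)"
  define W :: "'a \<Rightarrow> real ^ 'd" where "W = (\<lambda>\<omega>. \<chi> i. d * \<bar>Z \<omega> $ i\<bar> / S \<omega>)"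
  define M' where "M' = density M (\<lambda>\<omega>. ennreal (S \<omega> / d))"
  have [measurable]: "S \<in> borel_measurable M" unfolding S_def by simp
  have W[measurable]: "W \<in> borel_measurable M"
    unfolding W_def by (subst borel_measurable_vec_iff) simp
  have S0: "S \<omega> \<ge> 0" for \<omega> by (auto simp: S_def intro: sum_nonneg)
  have le: "\<bar>Z \<omega> $ i\<bar> \<le> S \<omega>" for \<omega> i
    unfolding S_def by (rule member_le_sum) auto
  show W0: "0 \<le> W \<omega> $ i" for \<omega> i using S0 d by (simp add: W_def)
  show "W \<omega> $ i \<le> real CARD('d)" for \<omega> i
    using S0[of \<omega>] d le[of \<omega> i] unfolding d_def[symmetric]
    by (cases "S \<omega> = 0") (auto simp: W_def divide_simps)
  have SW: "S \<omega> / d * W \<omega> $ i = \<bar>Z \<omega> $ i\<bar>" for \<omega> i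
    using d le[of \<omega> i] by (cases "S \<omega> = 0") (auto simp: W_def)
  have abs1: "(\<integral>\<omega>. \<bar>Z \<omega> $ i\<bar> \<partial>M) = 1" for i
  proof -
    have "(\<integral>\<omega>. \<bar>Z \<omega> $ i\<bar> \<partial>M) = (\<integral>\<omega>. Z \<omega> $ i \<partial>M)"
      by (rule integral_cong_AE) (use pos in auto)
    then show ?thesis using assms by (simp add: generator_def)
  qed
  have intZ: "integrable M (\<lambda>\<omega>. \<bar>Z \<omega> $ i\<bar>)" for i
    using assms by (auto simp: generator_def)
  have "emeasure M' (space M') = (\<integral>\<^sup>+\<omega>. ennreal (S \<omega> / d) \<partial>M)"
    unfolding M'_def by (simp add: emeasure_density cong: nn_integral_cong)
  also have "\<dots> = ennreal (\<integral>\<omega>. S \<omega> / d \<partial>M)"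
    by (rule nn_integral_eq_integral) (use intZ S0 d in \<open>auto simp: S_def\<close>)
  also have "(\<integral>\<omega>. S \<omega> / d \<partial>M) = 1"
    using intZ abs1 d by (simp add: S_def d_def)
  finally have "prob_space M'" by (intro prob_spaceI) simp
  moreover have "integrable M' (\<lambda>\<omega>. W \<omega> $ i)" "(\<integral>\<omega>. W \<omega> $ i \<partial>M') = 1" for i
    using intZ[of i] abs1[of i] S0 d SW unfolding M'_def
    by (simp_all add: integrable_density integral_density)
  ultimately show "generator M' W"
    using W0 W by (simp add: generator_def M'_def)
  show "dnorm M' W = dnorm M Z"
  proof
    fix x :: "real ^ 'd"
    have "dnorm M' W x = (\<integral>\<omega>. S \<omega> / d * (MAX i. \<bar>x $ i\<bar> * W \<omega> $ i) \<partial>M)"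
      unfolding dnorm_def M'_def by (subst integral_density) (use S0 d in auto)
    also have "\<dots> = (\<integral>\<omega>. (MAX i. \<bar>x $ i\<bar> * (S \<omega> / d * W \<omega> $ i)) \<partial>M)"
    proof (rule Bochner_Integration.integral_cong)
      fix \<omega>
      show "S \<omega> / d * (MAX i. \<bar>x $ i\<bar> * W \<omega> $ i) = (MAX i. \<bar>x $ i\<bar> * (S \<omega> / d * W \<omega> $ i))"
        using S0 d by (subst mult_Max_vec) (simp_all only: mult.left_commute divide_nonneg_pos)
    qed simp
    also have "\<dots> = (\<integral>\<omega>. (MAX i. \<bar>x $ i\<bar> * Z \<omega> $ i) \<partial>M)"
      unfolding SW
    proof (rule integral_cong_AE)
      show "AE \<omega> in M. (MAX i. \<bar>x $ i\<bar> * \<bar>Z \<omega> $ i\<bar>) = (MAX i. \<bar>x $ i\<bar> * Z \<omega> $ i)"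
        using pos by eventually_elim simp
      show "(\<lambda>\<omega>. MAX i. \<bar>x $ i\<bar> * \<bar>Z \<omega> $ i\<bar>) \<in> borel_measurable M"
        by (intro borel_measurable_Max) auto
    qed measurable
    finally show "dnorm M' W x = dnorm M Z x" by (simp add: dnorm_def)
  qed
qed

section \<open>Schoenberg's space-filling curve and its Borel section\<close>

text \<open>
  The building block of Schoenberg's curve: a continuous \<open>1\<close>-periodic function that reads off the
  first base-4 digit after the point of a number all of whose digits after the point are \<open>0\<close>
  or \<open>1\<close>, since the fractional part
  then lies in \<open>[0, 1/12]\<close> or \<open>[1/4, 1/3]\<close>.
\<close>

definition bump :: "real \<Rightarrow> real" where
  "bump t = max 0 (min 1 (4 * sin (2 * pi * t) - 2))"

lemma bump_bounds: "0 \<le> bump t" "bump t \<le> 1"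
  by (auto simp: bump_def)

lemma bump_add_int: "bump (of_int m + t) = bump t"
proof -
  have "sin (2 * pi * (of_int m + t)) = sin (2 * pi * t)"
    by (simp add: distrib_left sin_add sin_int_2pin cos_int_2pin mult_ac)
      (metis cos_int_2pin sin_int_2pin mult.commute mult.left_commute mult_1 mult_zero_left add_0)
  then show ?thesis by (simp add: bump_def)
qed

lemma bump_low:
  assumes "0 \<le> t" "t \<le> 1 / 12"
  shows "bump t = 0"
proof -
  have "pi * t \<le> pi / 12" using mult_left_mono[OF assms(2), of pi] by simp
  \<comment> \<open>The value \<open>sin (pi / 6) = 1 / 2\<close> is where
    \<open>4 * sin - 2\<close> reaches the lower clipping level 0.\<close>
  then have "sin (2 * pi * t) \<le> sin (pi / 6)"
    using assms by (intro sin_monotone_2pi_le) (auto simp: mult_ac intro: order_trans[of _ 0])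
  then show ?thesis by (simp add: bump_def sin_30)
qed

lemma bump_high:
  assumes "1 / 4 \<le> t" "t \<le> 1 / 3"
  shows "bump t = 1"
proof -
  have "pi * t \<le> pi / 3" using mult_left_mono[OF assms(2), of pi] by simp
  moreover have "pi * t \<ge> pi / 4" using mult_left_mono[OF assms(1), of pi] by simp
  \<comment> \<open>Reflection at \<open>pi / 2\<close> moves the angle from [\<open>pi / 2\<close>,
    \<open>2 * pi / 3\<close>] to [\<open>pi / 3\<close>, \<open>pi / 2\<close>], where sine
    increases.\<close>
  ultimately have "sin (pi / 3) \<le> sin (pi - 2 * pi * t)"
    using pi_gt_zero by (intro sin_monotone_2pi_le) linarith+
  then have "sqrt 3 / 2 \<le> sin (2 * pi * t)" by (simp add: sin_60)
  \<comment> \<open>This yields \<open>4 * (sqrt 3 / 2) - 2 \<ge> 1\<close>, the upper clipping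
    level.\<close>
  moreover have "3 / 2 \<le> sqrt 3" by (rule real_le_rsqrt) (simp add: power2_eq_square)
  ultimately show ?thesis by (simp add: bump_def)
qed

definition base4 :: "(nat \<Rightarrow> int) \<Rightarrow> real" where
  "base4 a = (\<Sum>n. of_int (a n) / 4 ^ Suc n)"

lemma base4_summable:
  assumes "\<And>n. a n \<in> {0, 1}"
  shows "summable (\<lambda>n. of_int (a n) / 4 ^ Suc n :: real)"
proof (rule summable_comparison_test')
  show "summable (\<lambda>n. (1 / 4) ^ Suc n :: real)"
    by (subst summable_Suc_iff) (simp add: summable_geometric)
  show "norm (of_int (a n) / 4 ^ Suc n :: real) \<le> (1 / 4) ^ Suc n" for n
    using assms[of n] by (auto simp: power_divide)
qed

text \<open>Comparison with the series all of whose digits are 1. A tail of at most 1/3 behind a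
  leading digit keeps the number inside one of the two intervals on which \<open>bump\<close> is
  constant.\<close>

lemma base4_bounds:
  assumes "\<And>n. a n \<in> {0, 1}"
  shows "0 \<le> base4 a" "base4 a \<le> 1 / 3"
proof -
  have *: "(\<lambda>n. (1 / 4) ^ Suc n :: real) sums (1 / 3)"
    using sums_mult[OF geometric_sums[of "1 / 4 :: real"], of "1 / 4"] by simp
  have a: "0 \<le> a n" "a n \<le> 1" for n using assms[of n] by auto
  show "0 \<le> base4 a"
    unfolding base4_def by (intro suminf_nonneg base4_summable assms) (simp add: a)
  have "base4 a \<le> (\<Sum>n. (1 / 4) ^ Suc n)"
    unfolding base4_def
    by (intro suminf_le base4_summable assms sums_summable[OF *])
      (use a in \<open>auto simp: power_divide divide_right_mono\<close>)
  then show "base4 a \<le> 1 / 3" using sums_unique[OF *] by simp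
qed

lemma base4_shift:
  assumes "\<And>n. a n \<in> {0, 1}"
  shows "4 * base4 a = of_int (a 0) + base4 (\<lambda>n. a (Suc n))"
  using suminf_split_head[OF base4_summable[of a]]
    suminf_mult[OF base4_summable[of "\<lambda>n. a (Suc n)"], of "1/4"] assms
  by (simp add: base4_def)

text \<open>Multiplication by \<open>4 ^ n\<close> moves \<open>n\<close> digits in front of the
  point; they form the integer \<open>m\<close>, which the periodic function \<open>bump\<close>
  ignores.\<close>

lemma power_mult_base4:
  assumes "\<And>n. a n \<in> {0, 1}"
  shows "\<exists>m. 4 ^ n * base4 a = of_int m + base4 (\<lambda>k. a (n + k))"
proof (induction n)
  case (Suc n)
  then obtain m where "4 ^ n * base4 a = of_int m + base4 (\<lambda>k. a (n + k))" by blast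
  then have "4 ^ Suc n * base4 a = of_int (4 * m + a n) + base4 (\<lambda>k. a (Suc n + k))"
    using base4_shift[of "\<lambda>k. a (n + k)"] assms by simp
  then show ?case by blast
qed (auto intro: exI[of _ 0])

lemma bump_power_mult_base4:
  assumes "\<And>n. a n \<in> {0, 1}"
  shows "bump (4 ^ n * base4 a) = of_int (a n)"
proof -
  obtain m where m: "4 ^ n * base4 a = of_int m + base4 (\<lambda>k. a (n + k))"
    using power_mult_base4[of a n] assms by blast
  have "4 * base4 (\<lambda>k. a (n + k)) = of_int (a n) + base4 (\<lambda>k. a (Suc n + k))"
    using base4_shift[of "\<lambda>k. a (n + k)"] assms by simp
  moreover have "0 \<le> base4 (\<lambda>k. a (Suc n + k))" "base4 (\<lambda>k. a (Suc n + k)) \<le> 1 / 3"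
    using base4_bounds[of "\<lambda>k. a (Suc n + k)"] assms by blast+
  ultimately show ?thesis
    using assms[of n] unfolding m bump_add_int
    by (auto intro!: bump_low bump_high)
qed

definition bindigit :: "real \<Rightarrow> nat \<Rightarrow> int" where
  "bindigit y k = \<lfloor>2 ^ Suc k * y\<rfloor> mod 2"

text \<open>The first \<open>n\<close> digits sum to
  \<open>\<lfloor>2 ^ n * y\<rfloor> / 2 ^ n\<close>, which differs from \<open>y\<close> by at most
  \<open>1 / 2 ^ n\<close>. At \<open>y = 1\<close> all these digits would be 0.\<close>

lemma bindigit_sums:
  assumes "0 \<le> y" "y < 1"
  shows "(\<lambda>k. of_int (bindigit y k) / 2 ^ Suc k) sums y"
proof -
  have step: "\<lfloor>2 ^ Suc n * y\<rfloor> = 2 * \<lfloor>2 ^ n * y\<rfloor> + bindigit y n" for n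
  proof -
    have "\<lfloor>2 ^ n * y\<rfloor> = \<lfloor>2 ^ Suc n * y\<rfloor> div 2"
      using floor_divide_real_eq_div[of 2 "2 ^ Suc n * y"] by simp
    then show ?thesis unfolding bindigit_def by simp
  qed
  have part: "(\<Sum>k<n. of_int (bindigit y k) / 2 ^ Suc k) = of_int \<lfloor>2 ^ n * y\<rfloor> / (2 ^ n :: real)" for n
  proof (induction n)
    case 0
    have "\<lfloor>y\<rfloor> = 0" using assms by linarith
    then show ?case by simp
  next
    case (Suc n)
    then show ?case unfolding step by (simp add: field_simps)
  qed
  have lim0: "(\<lambda>n. (1 / 2) ^ n :: real) \<longlonglongrightarrow> 0"
    by (rule LIMSEQ_power_zero) simp
  have "(\<lambda>n. of_int \<lfloor>2 ^ n * y\<rfloor> / (2 ^ n :: real)) \<longlonglongrightarrow> y"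
  proof (rule tendsto_sandwich[of "\<lambda>n. y - (1 / 2) ^ n" _ _ "\<lambda>_. y"])
    have "y \<le> (1 + of_int \<lfloor>2 ^ n * y\<rfloor>) / 2 ^ n" "of_int \<lfloor>2 ^ n * y\<rfloor> / 2 ^ n \<le> y" for n
      by (simp_all add: pos_divide_le_eq pos_le_divide_eq mult.commute[of y] add.commute[of 1])
    then have "y - (1 / 2) ^ n \<le> of_int \<lfloor>2 ^ n * y\<rfloor> / 2 ^ n" "of_int \<lfloor>2 ^ n * y\<rfloor> / 2 ^ n \<le> y" for n
      by (simp_all add: power_divide add_divide_distrib diff_le_eq add.commute)
    then show "\<forall>\<^sub>F n in sequentially. y - (1 / 2) ^ n \<le> of_int \<lfloor>2 ^ n * y\<rfloor> / 2 ^ n"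
      "\<forall>\<^sub>F n in sequentially. of_int \<lfloor>2 ^ n * y\<rfloor> / 2 ^ n \<le> y"
      by simp_all
    show "(\<lambda>n. y - (1 / 2) ^ n) \<longlonglongrightarrow> y"
      using tendsto_diff[OF tendsto_const lim0] by simp
  qed auto
  then show ?thesis unfolding sums_def part .
qed

text \<open>The section \<open>s\<close> interleaves the binary digits of all coordinates into one
  base-4 number, digit \<open>k\<close> of coordinate \<open>i\<close> going to position
  \<open>e (i, k)\<close>. The curve \<open>g\<close> reads them back through \<open>bump\<close>
  and sums them with binary weights. These weights make the series converge uniformly, so
  \<open>g\<close> is continuous, while \<open>s\<close> only has to be measurable.\<close>

lemma schoenberg_curve:
  obtains g :: "real \<Rightarrow> real ^ 'd" and s :: "real ^ 'd \<Rightarrow> real" where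
    "continuous_on UNIV g" "s \<in> borel_measurable borel"
    "\<And>t i. 0 \<le> g t $ i" "\<And>t i. g t $ i \<le> 1"
    "\<And>y. 0 \<le> s y" "\<And>y. s y \<le> 1 / 3"
    "\<And>y. (\<forall>i. 0 \<le> y $ i \<and> y $ i < 1) \<Longrightarrow> g (s y) = y"
proof -
  obtain e :: "'d \<times> nat \<Rightarrow> nat" where e: "inj e"
    using countableE[of "UNIV :: ('d \<times> nat) set"] by auto
  define a :: "real ^ 'd \<Rightarrow> nat \<Rightarrow> int" where
    \<comment> \<open>Positions that \<open>e\<close> does not hit are filled with 0, so that all
      digits lie in {0, 1}.\<close>
    "a = (\<lambda>y n. if n \<in> range e then bindigit (y $ fst (inv e n)) (snd (inv e n)) else 0)"
  have a01: "a y n \<in> {0, 1}" for y n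
    by (auto simp: a_def bindigit_def)
  have ae: "a y (e (i, k)) = bindigit (y $ i) k" for y i k
    using e by (simp add: a_def)
  define s where "s = (\<lambda>y. base4 (a y))"
  define h :: "'d \<Rightarrow> real \<Rightarrow> real" where
    "h = (\<lambda>i t. \<Sum>k. bump (4 ^ e (i, k) * t) / 2 ^ Suc k)"
  define g :: "real \<Rightarrow> real ^ 'd" where "g = (\<lambda>t. \<chi> i. h i t)"
  have half: "(\<lambda>k. (1 / 2) ^ Suc k :: real) sums 1"
    by (rule power_half_series)
  have bd: "norm (bump (4 ^ e (i, k) * t) / 2 ^ Suc k) \<le> (1 / 2) ^ Suc k" for i k t
    using bump_bounds by (simp add: power_divide divide_right_mono)
  have summ: "summable (\<lambda>k. bump (4 ^ e (i, k) * t) / 2 ^ Suc k)" for i t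
    by (rule summable_comparison_test'[OF sums_summable[OF half] bd])
  show thesis
  proof
    have "continuous_on UNIV (h i)" for i
    proof (rule uniform_limit_theorem[where F = sequentially])
      show "uniform_limit UNIV (\<lambda>n t. \<Sum>k<n. bump (4 ^ e (i, k) * t) / 2 ^ Suc k) (h i) sequentially"
        unfolding h_def by (rule Weierstrass_m_test[OF bd sums_summable[OF half]])
    qed (auto simp: bump_def intro!: always_eventually continuous_intros)
    then show "continuous_on UNIV g"
      unfolding g_def by (intro continuous_intros)
    have "(\<lambda>y. a y n) \<in> measurable borel (count_space UNIV)" for n
    proof (cases "n \<in> range e")
      case True
      then show ?thesis unfolding a_def bindigit_def by simp
    next
      case False
      then show ?thesis unfolding a_def by simp
    qed
    note [measurable] = this
    show "s \<in> borel_measurable borel"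
      unfolding s_def base4_def by measurable
    show "0 \<le> g t $ i" for t i
      unfolding g_def h_def vec_lambda_beta
      by (intro suminf_nonneg summ divide_nonneg_nonneg bump_bounds) auto
    show "g t $ i \<le> 1" for t i
    proof -
      have "h i t \<le> (\<Sum>k. (1 / 2) ^ Suc k)"
        unfolding h_def
        by (intro suminf_le summ sums_summable[OF half] order_trans[OF abs_ge_self bd[unfolded real_norm_def]])
      then show ?thesis
        using sums_unique[OF half] by (simp add: g_def)
    qed
    show "0 \<le> s y" "s y \<le> 1 / 3" for y
      unfolding s_def by (intro base4_bounds a01)+
    show "g (s y) = y" if "\<forall>i. 0 \<le> y $ i \<and> y $ i < 1" for y
    proof -
      have "h i (s y) = y $ i" for i
        using sums_unique[OF bindigit_sums[of "y $ i"]] that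
        unfolding h_def s_def bump_power_mult_base4[OF a01] ae by simp
      then show ?thesis by (simp add: g_def vec_eq_iff)
    qed
  qed
qed

section \<open>Pointwise limits of D-norms\<close>

lemma tight_bounded_support:
  assumes "\<And>n. prob_space (M n)" and [measurable]: "\<And>n. X n \<in> borel_measurable (M n)"
    and b: "\<And>n \<omega>. l \<le> X n \<omega>" "\<And>n \<omega>. X n \<omega> \<le> (u :: real)"
  shows "tight (\<lambda>n. distr (M n) borel (X n))"
  unfolding tight_def
proof (intro conjI allI impI)
  fix n show "real_distribution (distr (M n) borel (X n))"
    using assms by (intro prob_space.real_distribution_distr) auto
next
  fix \<epsilon> :: real assume "\<epsilon> > 0"
  \<comment> \<open>The left end is lowered to \<open>l - 1\<close> because the interval is open
    there and \<open>l\<close> may carry mass; this also makes it nonempty when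
    \<open>l = u\<close>.\<close>
  have "measure (distr (M n) borel (X n)) {l - 1<..u} = 1" for n
  proof -
    have "X n -` {l - 1<..u} \<inter> space (M n) = space (M n)"
    proof -
      have "l - 1 < X n \<omega>" for \<omega> using b(1)[of n \<omega>] by linarith
      then show ?thesis using b(2) by auto
    qed
    then show ?thesis
      using prob_space.prob_space[OF assms(1)[of n]] by (simp add: measure_distr)
  qed
  moreover have "l \<le> u" using b order_trans by blast
  ultimately show "\<exists>a b. a < b \<and> (\<forall>n. 1 - \<epsilon> < measure (distr (M n) borel (X n)) {a<..b})"
    using \<open>\<epsilon> > 0\<close> by (intro exI[of _ "l - 1"] exI[of _ u]) auto
qed

text \<open>Induction over finite nonempty index sets reduces the claim to binary maxima.\<close>

lemma isCont_Max_vec: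
  fixes g :: "real \<Rightarrow> real ^ 'd"
  assumes "continuous_on UNIV g"
  shows "isCont (\<lambda>t. MAX i. \<bar>x $ i\<bar> * g t $ i) t"
proof -
  have "continuous_on UNIV (\<lambda>t. Max ((\<lambda>i. \<bar>x $ i\<bar> * g t $ i) ` I))"
    if "finite I" "I \<noteq> {}" for I :: "'d set"
    using that
    by (induction rule: finite_ne_induct) (auto intro!: continuous_intros assms)
  then show ?thesis
    by (simp add: continuous_on_eq_continuous_at)
qed

text \<open>Bounded generators \<open>W n\<close> are encoded as real variables \<open>T n\<close>
  with \<open>G (T n) = W n\<close>. A subsequence of the laws of \<open>T n\<close> converges
  weakly to some \<open>\<nu>\<close>, and \<open>G\<close> under \<open>\<nu>\<close> generates the
  limit: the means and the norms are integrals of bounded continuous functions of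
  \<open>G\<close>.\<close>

lemma is_dnorm_pointwise_limit:
  fixes N :: "nat \<Rightarrow> real ^ 'd \<Rightarrow> real"
  assumes N: "\<And>n. is_dnorm (N n)" and lim: "\<And>x. (\<lambda>n. N n x) \<longlonglongrightarrow> f x"
  shows "is_dnorm f"
proof -
  \<comment> \<open>One more than the bound on the generators, so that \<open>W / c\<close> has all
    components strictly below 1, where \<open>g\<close> inverts \<open>s\<close>.\<close>
  define c where "c = real CARD('d) + 1"
  have c: "c > 0" by (simp add: c_def)
  have "\<exists>(M :: (real ^ 'd) measure) W. generator M W \<and> dnorm M W = N n \<and>
      (\<forall>\<omega> i. 0 \<le> W \<omega> $ i \<and> W \<omega> $ i < c)" for n
  proof -
    obtain M0 :: "(real ^ 'd) measure" and Z where "generator M0 Z" "N n = dnorm M0 Z"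
      using N unfolding is_dnorm_def by blast
    then show ?thesis
      by (metis bounded_generator c_def le_less_trans less_add_one)
  qed
  then obtain M :: "nat \<Rightarrow> (real ^ 'd) measure" and W where
    gen: "\<And>n. generator (M n) (W n)" and WN: "\<And>n. dnorm (M n) (W n) = N n" and
    W: "\<And>n \<omega> i. 0 \<le> W n \<omega> $ i" "\<And>n \<omega> i. W n \<omega> $ i < c"
    by metis
  have M: "prob_space (M n)" and [measurable]: "W n \<in> borel_measurable (M n)" for n
    using gen by (auto simp: generator_def)
  obtain g :: "real \<Rightarrow> real ^ 'd" and s where
    g: "continuous_on UNIV g" and s: "s \<in> borel_measurable borel" and
    g01: "\<And>t i. 0 \<le> g t $ i" "\<And>t i. g t $ i \<le> 1" and
    s_bd: "\<And>y. 0 \<le> s y" "\<And>y. s y \<le> 1 / 3" and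
    gs: "\<And>y. (\<forall>i. 0 \<le> y $ i \<and> y $ i < 1) \<Longrightarrow> g (s y) = y"
    by (rule schoenberg_curve) blast
  note [measurable] = s
  define T where "T = (\<lambda>n \<omega>. s ((1 / c) *\<^sub>R W n \<omega>))"
  have [measurable]: "T n \<in> borel_measurable (M n)" for n unfolding T_def by measurable
  have T_bd: "0 \<le> T n \<omega>" "T n \<omega> \<le> 1 / 3" for n \<omega>
    unfolding T_def by (rule s_bd)+
  define \<mu> where "\<mu> n = distr (M n) borel (T n)" for n
  define G where "G t = c *\<^sub>R g t" for t
  have GT: "G (T n \<omega>) = W n \<omega>" for n \<omega>
    unfolding G_def T_def using W c by (subst gs) auto
  have contG: "continuous_on UNIV G" unfolding G_def by (intro continuous_intros g)
  then have [measurable]: "G \<in> borel_measurable borel"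
    by (rule borel_measurable_continuous_onI)
  have G: "0 \<le> G t $ i" "G t $ i \<le> c" for t i
    using g01[of t i] c by (simp_all add: G_def mult_left_le)
  have "tight \<mu>"
    unfolding \<mu>_def by (rule tight_bounded_support[OF M _ T_bd]) measurable
  then obtain r \<nu> where r: "strict_mono r" and \<nu>: "real_distribution \<nu>"
    and weak: "weak_conv_m (\<mu> \<circ> id \<circ> r) \<nu>"
    using tight_imp_convergent_subsubsequence[of \<mu> id] by (auto simp: strict_mono_id)
  interpret \<nu>: real_distribution \<nu> by fact
  have \<mu>: "real_distribution (\<mu> n)" for n
    using \<open>tight \<mu>\<close> by (simp add: tight_def)
  \<comment> \<open>Since \<open>W n = G (T n)\<close>, the integrals become integrals over the
    line, where weak convergence applies to \<open>h\<close> composed with \<open>G\<close>.\<close>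
  have conv: "(\<lambda>n. \<integral>\<omega>. h (W (r n) \<omega>) \<partial>M (r n)) \<longlonglongrightarrow> (\<integral>t. h (G t) \<partial>\<nu>)"
    if h: "h \<in> borel_measurable borel" "\<And>t. isCont (\<lambda>t. h (G t)) t" "\<And>t. norm (h (G t)) \<le> B"
    for h :: "real ^ 'd \<Rightarrow> real" and B
  proof -
    note [measurable] = h(1)
    have "(\<lambda>n. \<integral>t. h (G t) \<partial>(\<mu> \<circ> id \<circ> r) n) \<longlonglongrightarrow> (\<integral>t. h (G t) \<partial>\<nu>)"
      by (rule weak_conv_imp_integral_bdd_continuous_conv[OF _ \<nu> weak h(2,3)]) (simp add: \<mu>)
    then show ?thesis by (simp add: \<mu>_def integral_distr GT)
  qed
  have "generator \<nu> G"
    unfolding generator_def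
  proof (intro conjI allI)
    show "G \<in> borel_measurable \<nu>" by measurable
    fix i
    show "AE t in \<nu>. 0 \<le> G t $ i" using G by simp
    show "integrable \<nu> (\<lambda>t. G t $ i)"
      by (rule \<nu>.integrable_const_bound[of _ c]) (use G in auto)
    have "(\<lambda>n. \<integral>\<omega>. W (r n) \<omega> $ i \<partial>M (r n)) \<longlonglongrightarrow> (\<integral>t. G t $ i \<partial>\<nu>)"
    proof (rule conv)
      have "continuous_on UNIV (\<lambda>t. G t $ i)" by (intro continuous_intros contG)
      then show "isCont (\<lambda>t. G t $ i) t" for t by (simp add: continuous_on_eq_continuous_at)
      show "norm (G t $ i) \<le> c" for t using G[of t i] by simp
    qed simp
    then show "(\<integral>t. G t $ i \<partial>\<nu>) = 1"
      using gen by (simp add: generator_def LIMSEQ_const_iff)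
  qed (fact \<nu>.prob_space_axioms)
  moreover have "f = dnorm \<nu> G"
  proof
    fix x :: "real ^ 'd"
    have "(\<lambda>n. dnorm (M (r n)) (W (r n)) x) \<longlonglongrightarrow> dnorm \<nu> G x"
      unfolding dnorm_def
    proof (rule conv)
      show "(\<lambda>z. MAX i. \<bar>x $ i\<bar> * z $ i) \<in> borel_measurable borel" by measurable
      show "isCont (\<lambda>t. MAX i. \<bar>x $ i\<bar> * G t $ i) t" for t by (rule isCont_Max_vec[OF contG])
      show "norm (MAX i. \<bar>x $ i\<bar> * G t $ i) \<le> (\<Sum>i\<in>UNIV. \<bar>x $ i\<bar> * c)" for t
      proof -
        have "(\<Sum>i\<in>UNIV. \<bar>x $ i\<bar> * \<bar>G t $ i\<bar>) \<le> (\<Sum>i\<in>UNIV. \<bar>x $ i\<bar> * c)"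
          by (intro sum_mono mult_left_mono) (auto simp: G)
        then show ?thesis
          unfolding real_norm_def by (rule order_trans[OF Max_le_sum_abs])
      qed
    qed
    \<comment> \<open>Convergence of the full sequence identifies the subsequential limit with
      \<open>f\<close>.\<close>
    moreover have "(\<lambda>n. N (r n) x) \<longlonglongrightarrow> f x"
      using LIMSEQ_subseq_LIMSEQ[OF lim r] by (simp add: comp_def)
    ultimately show "f x = dnorm \<nu> G x"
      unfolding WN by (rule LIMSEQ_unique[rotated])
  qed
  \<comment> \<open>The sample space of \<open>\<nu>\<close> is the line; passing to the law of
    \<open>G\<close> gives a generator on \<open>real ^ 'd\<close>.\<close>
  ultimately show ?thesis by (simp add: is_dnorm_dnorm)
qed

section \<open>Convergence of the iterated products\<close>

theorem proposition4p2:
  fixes D :: "nat \<Rightarrow> real ^ 'd \<Rightarrow> real"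
  assumes "\<And>n. is_dnorm (D n)"
  shows "(\<forall>x. convergent (\<lambda>n. dnorm_prod D n x)) \<and>
         is_dnorm (\<lambda>x. lim (\<lambda>n. dnorm_prod D n x))"
proof -
  have P: "is_dnorm (dnorm_prod D n)" for n
    by (induction n) (simp_all add: assms is_dnorm_dnorm_mult)
  have conv: "convergent (\<lambda>n. dnorm_prod D n x)" for x
  proof -
    have "incseq (\<lambda>n. dnorm_prod D n x)"
      by (rule incseq_SucI) (simp add: dnorm_mult_ge assms P)
    then obtain L where "(\<lambda>n. dnorm_prod D n x) \<longlonglongrightarrow> L"
      using is_dnorm_le_sum_abs[OF P] by (rule incseq_convergent[OF _ allI])
    then show ?thesis by (rule convergentI)
  qed
  moreover have "is_dnorm (\<lambda>x. lim (\<lambda>n. dnorm_prod D n x))"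
    using conv by (intro is_dnorm_pointwise_limit[OF P]) (simp add: convergent_LIMSEQ_iff)
  ultimately show ?thesis by blast
qed

end
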